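(* For every variable $x\in V$, every command $c\in\mathcal C$ and every relation $r\subseteq\Sigma\times\Sigma$, $$(\mathbf{var}\,x\cdot c)\Cap\mathbf{rely}\,r\;\ge\;(\mathbf{var}\,x\cdot c\Cap\mathbf{rely}(\mathsf E_xr)).$$
   Context: Commands. $(\mathcal C,\le,\bigwedge,\bigsqcup,\bot,\top)$ is a complete distributive lattice (with arbitrary meet $\bigwedge$, binary meet $\sqcap$, arbitrary join $\bigsqcup$ and binary join $\sqcup$) whose elements are called commands ($c\ge d$ is read "$c$ is refined by $d$"). It has an associative sequential composition $;$ with identity $\mathbf{nil}$, monotone in both arguments, and an associative, commutative, idempotent, monotone weak conjunction $\Cap$. Iterations: $c^0=\mathbf{nil}$, $c^{i+1}=c;c^i$; $c^\star$ (resp. $c^\omega$) is the least (resp. greatest) fixed point of $y\mapsto\mathbf{nil}\sqcup c;y$; $c^\infty=c^\omega;\bot$. One has $c^\star=\bigsqcup_{i\in\mathbb N}c^i$ and $c^\omega=c^\star\sqcup c^\infty$. States and relations. $V$ is a countable set of variables, $S$ a set, $\Sigma$ the set of partial functions $V\rightharpoonup S$. For $W\subseteq V$, $\mathrm{id}(W)$ relates $\sigma,\sigma'\in\Sigma$ iff they agree on every variable in $W$; $\mathrm{id}(x)=\mathrm{id}(\{x\})$, $\mathrm{id}(\overline x)=\mathrm{id}(V\setminus\{x\})$, and $\mathrm{id}$ is the identity relation on $\Sigma$. For $p\subseteq\Sigma$, $\mathsf E_x p$ is the image of $p$ under $\mathrm{id}(\overline x)$. For $r\subseteq\Sigma\times\Sigma$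 (with $\circ$ denoting left-to-right relational composition), $\mathsf E^{\mathsf{first}}_x r=\mathrm{id}(\overline x)\circ r$, $\mathsf E^{\mathsf{last}}_x r=r\circ\mathrm{id}(\overline x)$, $\mathsf E_x r=\mathrm{id}(\overline x)\circ r\circ\mathrm{id}(\overline x)$. $\overline r$ is the complement of $r$. Primitive commands. $\tau:\mathcal P(\Sigma)\to\mathcal C$ (tests) and $\pi,\epsilon:\mathcal P(\Sigma\times\Sigma)\to\mathcal A$ (program and environment steps) are injective homomorphisms of complete Boolean algebras onto complete Boolean sub-algebras of $\mathcal C$ (joins, and nonempty meets, computed in $\mathcal C$; complement relative to the greatest element of the sub-algebra), with $\tau(\emptyset)=\pi(\emptyset)=\epsilon(\emptyset)=\bot$ and $\tau(\Sigma)=\mathbf{nil}$. $\mathcal A\subseteq\mathcal C$ is the complete Boolean sub-algebra of atomic steps, in which $\boldsymbol\pi=\pi(\Sigma\times\Sigma)$ and $\boldsymbol\epsilon=\epsilon(\Sigma\times\Sigma)$ are complementary; $\boldsymbol\alpha=\boldsymbol\pi\sqcup\boldsymbol\epsilon$. $\mathbf{chaos}=\boldsymbol\alpha^\omega$ is the identity of $\Cap$, and $a=a\Cap(\boldsymbol\alpha;\mathbf{chaos})$ for all $a\in\mathcal A$. Localisation. For each $x\in V$ there are unary operators $\mathsf E_x,\mathsf E^{\mathsf{first}}_x,\mathsf E^{\mathsf{last}}_x$ on $\mathcal C$ (binding tighter than binary operators). Each family $F\in\{\mathsf E,\mathsf E^{\mathsf{first}},\mathsf E^{\mathsf{last}}\}$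 satisfies $c\le F_xc$; $F_x(c\sqcap F_xd)=F_xc\sqcap F_xd$; $F_xF_yc=F_yF_xc$; $F_x(\bigsqcup C)=\bigsqcup_{c\in C}F_xc$. Further axioms: $\mathsf E^{\mathsf{first}}_xc\le\mathsf E_xc$; $\mathsf E^{\mathsf{last}}_xc\le\mathsf E_xc$; $\mathsf E_x\mathsf E^{\mathsf{first}}_yc=\mathsf E^{\mathsf{first}}_y\mathsf E_xc$; $\mathsf E_x\mathsf E^{\mathsf{last}}_yc=\mathsf E^{\mathsf{last}}_y\mathsf E_xc$; $\mathsf E^{\mathsf{first}}_x\mathsf E^{\mathsf{last}}_yc=\mathsf E^{\mathsf{last}}_y\mathsf E^{\mathsf{first}}_xc$; $\mathsf E_x\tau(p)=\mathsf E^{\mathsf{first}}_x\tau(p)=\mathsf E^{\mathsf{last}}_x\tau(p)=\tau(\mathsf E_xp)$; $F_x\pi(r)=\pi(F_xr)$ and $F_x\epsilon(r)=\epsilon(F_xr)$ for each of the three $F$; $\mathsf E_x(c;\mathsf E^{\mathsf{first}}_xd)=\mathsf E_xc;\mathsf E_xd=\mathsf E_x(\mathsf E^{\mathsf{last}}_xc;d)$; if $c=c\Cap(\boldsymbol\alpha;\mathbf{chaos})$ then $\mathsf E^{\mathsf{first}}_x(c;d)=\mathsf E^{\mathsf{first}}_xc;d$ and $\mathsf E^{\mathsf{last}}_x(d;c)=d;\mathsf E^{\mathsf{last}}_xc$; $\mathsf E_x(c\Cap\mathsf E_xd)=\mathsf E_xc\Cap\mathsf E_xd$; $\mathsf E^{\mathsf{first}}_x(c\Cap\mathsf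 E^{\mathsf{first}}_xd)=\mathsf E^{\mathsf{first}}_xc\Cap\mathsf E^{\mathsf{first}}_xd$; for $a\in\mathcal A$ with $\mathsf E_xa=\mathsf E^{\mathsf{last}}_xa$, $\mathsf E_x(a^\infty)=(\mathsf E_xa)^\infty$. Derived commands. $\mathbf{guar}\,g=(\pi(g)\sqcup\boldsymbol\epsilon)^\omega$; $\mathbf{demand}\,r=(\epsilon(r)\sqcup\boldsymbol\pi)^\omega$; $\mathbf{rely}\,r=(\boldsymbol\alpha\sqcup\epsilon(\overline r);\top)^\omega=\boldsymbol\alpha^\omega;(\mathbf{nil}\sqcup\epsilon(\overline r);\top)$; $\mathbf{term}=\boldsymbol\alpha^\star;\boldsymbol\epsilon^\omega$; $\mathbf{idle}=\mathbf{term}\Cap\mathbf{guar}\,\mathrm{id}$. Known properties of the algebra: $\mathbf{rely}\,r_1\ge\mathbf{rely}\,r_2$ if $r_1\subseteq r_2$; $\mathbf{rely}\,r\Cap c\ge c$; $\mathbf{rely}\,r_1\Cap\mathbf{rely}\,r_2=\mathbf{rely}(r_1\cap r_2)$; $\mathbf{rely}\,r\Cap(c;d)\ge(\mathbf{rely}\,r\Cap c);(\mathbf{rely}\,r\Cap d)$; $\mathbf{demand}\,r\Cap\mathbf{rely}\,r=\mathbf{demand}\,r$. Local blocks. $(\mathbf{local}\,x\cdot c)=\mathsf E_x(\mathbf{demand}\,\mathrm{id}(x)\Cap c)\Cap\mathbf{guar}\,\mathrm{id}(x)$ and $(\mathbf{var}\,x\cdot c)=\mathbf{idle};(\mathbf{local}\,x\cdot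 c);\mathbf{idle}$. *)

theory Defs
  imports Main "HOL-Library.Countable_Set"
begin

unbundle lattice_syntax

section \<open>Signature\<close>

text \<open>
  The commands are the elements of a type \<open>'c\<close> that is a complete distributive lattice;
  \<open>c \<ge> d\<close> reads ``\<open>c\<close> is refined by \<open>d\<close>''. Distributive means distributive for binary
  joins and meets, not completely distributive. The set of variables and the set of values
  are carrier sets, so that either of them may be empty.
\<close>

type_synonym ('v, 's) state = "'v \<rightharpoonup> 's"

record ('v, 's, 'c) command_algebra =
  vars    :: "'v set"
  vals    :: "'s set"
  seq     :: "'c \<Rightarrow> 'c \<Rightarrow> 'c"  (infixr \<open>;;\<index>\<close> 75)
  nil     :: "'c"
  wconj   :: "'c \<Rightarrow> 'c \<Rightarrow> 'c"  (infixl \<open>\<Cap>\<index>\<close> 68)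
  test    :: "('v, 's) state set \<Rightarrow> 'c"
  pstep   :: "('v, 's) state rel \<Rightarrow> 'c"
  estep   :: "('v, 's) state rel \<Rightarrow> 'c"
  atomic  :: "'c set"
  E       :: "'v \<Rightarrow> 'c \<Rightarrow> 'c"
  E_first :: "'v \<Rightarrow> 'c \<Rightarrow> 'c"
  E_last  :: "'v \<Rightarrow> 'c \<Rightarrow> 'c"


section \<open>States and relations\<close>

definition states :: "('v, 's, 'c) command_algebra \<Rightarrow> ('v, 's) state set" where
  "states M = {\<sigma>. dom \<sigma> \<subseteq> vars M \<and> ran \<sigma> \<subseteq> vals M}"

text \<open>\<open>agree M W\<close> is \<open>id(W)\<close>; two states also agree on a variable where both are undefined.\<close>

definition agree :: "('v, 's, 'c) command_algebra \<Rightarrow> 'v set \<Rightarrow> ('v, 's) state rel" where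
  "agree M W = {(\<sigma>, \<sigma>'). \<sigma> \<in> states M \<and> \<sigma>' \<in> states M \<and> (\<forall>y\<in>W. \<sigma> y = \<sigma>' y)}"

abbreviation id_on_var :: "('v, 's, 'c) command_algebra \<Rightarrow> 'v \<Rightarrow> ('v, 's) state rel" where
  "id_on_var M x \<equiv> agree M {x}"

abbreviation id_off_var :: "('v, 's, 'c) command_algebra \<Rightarrow> 'v \<Rightarrow> ('v, 's) state rel" where
  "id_off_var M x \<equiv> agree M (vars M - {x})"

definition compl_rel ::
    "('v, 's, 'c) command_algebra \<Rightarrow> ('v, 's) state rel \<Rightarrow> ('v, 's) state rel" where
  "compl_rel M r = (states M \<times> states M) - r"

definition E_set ::
    "('v, 's, 'c) command_algebra \<Rightarrow> 'v \<Rightarrow> ('v, 's) state set \<Rightarrow> ('v, 's) state set" where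
  "E_set M x p = id_off_var M x `` p"

definition E_first_rel ::
    "('v, 's, 'c) command_algebra \<Rightarrow> 'v \<Rightarrow> ('v, 's) state rel \<Rightarrow> ('v, 's) state rel" where
  "E_first_rel M x r = id_off_var M x O r"

definition E_last_rel ::
    "('v, 's, 'c) command_algebra \<Rightarrow> 'v \<Rightarrow> ('v, 's) state rel \<Rightarrow> ('v, 's) state rel" where
  "E_last_rel M x r = r O id_off_var M x"

definition E_rel ::
    "('v, 's, 'c) command_algebra \<Rightarrow> 'v \<Rightarrow> ('v, 's) state rel \<Rightarrow> ('v, 's) state rel" where
  "E_rel M x r = id_off_var M x O r O id_off_var M x"


section \<open>Complete Boolean subalgebras of the lattice of commands\<close>

text \<open>
  Joins and nonempty meets are those of the ambient lattice (the empty join makes \<open>\<bottom>\<close> the least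
  element of a subalgebra), while the greatest element of a subalgebra \<open>B\<close> is \<open>\<Squnion>B\<close>, which
  need not be \<open>\<top>\<close>.
\<close>

definition complementary_in :: "'c::complete_lattice set \<Rightarrow> 'c \<Rightarrow> 'c \<Rightarrow> bool" where
  "complementary_in B a b \<longleftrightarrow> a \<in> B \<and> b \<in> B \<and> a \<sqinter> b = \<bottom> \<and> a \<squnion> b = \<Squnion>B"

definition complete_boolean_subalgebra :: "'c::complete_lattice set \<Rightarrow> bool" where
  "complete_boolean_subalgebra B \<longleftrightarrow>
     (\<forall>X\<subseteq>B. \<Squnion>X \<in> B) \<and>
     (\<forall>X\<subseteq>B. X \<noteq> {} \<longrightarrow> \<Sqinter>X \<in> B) \<and>
     (\<forall>a\<in>B. \<exists>b. complementary_in B a b)"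

text \<open>
  An injective homomorphism from the power set algebra of \<open>U\<close> onto a complete Boolean subalgebra;
  values outside \<open>Pow U\<close> are irrelevant.
\<close>

definition powerset_embedding :: "'a set \<Rightarrow> ('a set \<Rightarrow> 'c::complete_lattice) \<Rightarrow> bool" where
  "powerset_embedding U f \<longleftrightarrow>
     inj_on f (Pow U) \<and>
     complete_boolean_subalgebra (f ` Pow U) \<and>
     (\<forall>P\<subseteq>Pow U. f (\<Union>P) = \<Squnion>(f ` P)) \<and>
     (\<forall>P\<subseteq>Pow U. P \<noteq> {} \<longrightarrow> f (\<Inter>P) = \<Sqinter>(f ` P)) \<and>
     (\<forall>p\<subseteq>U. complementary_in (f ` Pow U) (f p) (f (U - p)))"


section \<open>Iterations and derived commands\<close>

primrec cpow :: "('v, 's, 'c) command_algebra \<Rightarrow> 'c \<Rightarrow> nat \<Rightarrow> 'c" where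
  "cpow M c 0 = nil M"
| "cpow M c (Suc i) = c ;;\<^bsub>M\<^esub> cpow M c i"

definition star :: "('v, 's, 'c::complete_lattice) command_algebra \<Rightarrow> 'c \<Rightarrow> 'c" where
  "star M c = lfp (\<lambda>y. nil M \<squnion> (c ;;\<^bsub>M\<^esub> y))"

definition omega :: "('v, 's, 'c::complete_lattice) command_algebra \<Rightarrow> 'c \<Rightarrow> 'c" where
  "omega M c = gfp (\<lambda>y. nil M \<squnion> (c ;;\<^bsub>M\<^esub> y))"

definition infiter :: "('v, 's, 'c::complete_lattice) command_algebra \<Rightarrow> 'c \<Rightarrow> 'c" where
  "infiter M c = omega M c ;;\<^bsub>M\<^esub> \<bottom>"

definition any_pstep :: "('v, 's, 'c) command_algebra \<Rightarrow> 'c" where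
  "any_pstep M = pstep M (states M \<times> states M)"

definition any_estep :: "('v, 's, 'c) command_algebra \<Rightarrow> 'c" where
  "any_estep M = estep M (states M \<times> states M)"

definition any_step :: "('v, 's, 'c::complete_lattice) command_algebra \<Rightarrow> 'c" where
  "any_step M = any_pstep M \<squnion> any_estep M"

definition chaos :: "('v, 's, 'c::complete_lattice) command_algebra \<Rightarrow> 'c" where
  "chaos M = omega M (any_step M)"

definition guar ::
    "('v, 's, 'c::complete_lattice) command_algebra \<Rightarrow> ('v, 's) state rel \<Rightarrow> 'c" where
  "guar M g = omega M (pstep M g \<squnion> any_estep M)"

definition demand ::
    "('v, 's, 'c::complete_lattice) command_algebra \<Rightarrow> ('v, 's) state rel \<Rightarrow> 'c" where
  "demand M r = omega M (estep M r \<squnion> any_pstep M)"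

definition rely ::
    "('v, 's, 'c::complete_lattice) command_algebra \<Rightarrow> ('v, 's) state rel \<Rightarrow> 'c" where
  "rely M r = omega M (any_step M \<squnion> (estep M (compl_rel M r) ;;\<^bsub>M\<^esub> \<top>))"

definition terminating :: "('v, 's, 'c::complete_lattice) command_algebra \<Rightarrow> 'c" where
  "terminating M = star M (any_step M) ;;\<^bsub>M\<^esub> omega M (any_estep M)"

definition idle :: "('v, 's, 'c::complete_lattice) command_algebra \<Rightarrow> 'c" where
  "idle M = terminating M \<Cap>\<^bsub>M\<^esub> guar M (Id_on (states M))"

definition local_block ::
    "('v, 's, 'c::complete_lattice) command_algebra \<Rightarrow> 'v \<Rightarrow> 'c \<Rightarrow> 'c" where
  "local_block M x c =
     E M x (demand M (id_on_var M x) \<Cap>\<^bsub>M\<^esub> c) \<Cap>\<^bsub>M\<^esub> guar M (id_on_var M x)"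

definition var_block ::
    "('v, 's, 'c::complete_lattice) command_algebra \<Rightarrow> 'v \<Rightarrow> 'c \<Rightarrow> 'c" where
  "var_block M x c = idle M ;;\<^bsub>M\<^esub> (local_block M x c ;;\<^bsub>M\<^esub> idle M)"


section \<open>The axioms\<close>

locale localisation_algebra =
  fixes M :: "('v, 's, 'c::{complete_lattice, distrib_lattice}) command_algebra" (structure)
  assumes countable_vars: "countable (vars M)"
    \<comment> \<open>sequential composition and weak conjunction\<close>
    and seq_assoc: "(c ;; d) ;; e = c ;; (d ;; e)"
    and seq_nil_left: "nil M ;; c = c"
    and seq_nil_right: "c ;; nil M = c"
    and seq_mono: "\<lbrakk>c \<le> c'; d \<le> d'\<rbrakk> \<Longrightarrow> c ;; d \<le> c' ;; d'"
    and wconj_assoc: "(c \<Cap> d) \<Cap> e = c \<Cap> (d \<Cap> e)"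
    and wconj_commute: "c \<Cap> d = d \<Cap> c"
    and wconj_idem: "c \<Cap> c = c"
    and wconj_mono: "\<lbrakk>c \<le> c'; d \<le> d'\<rbrakk> \<Longrightarrow> c \<Cap> d \<le> c' \<Cap> d'"
    \<comment> \<open>iterations\<close>
    and star_eq: "star M c = (\<Squnion>i. cpow M c i)"
    and omega_eq: "omega M c = star M c \<squnion> infiter M c"
    \<comment> \<open>primitive commands\<close>
    and test_embedding: "powerset_embedding (states M) (test M)"
    and pstep_embedding: "powerset_embedding (states M \<times> states M) (pstep M)"
    and estep_embedding: "powerset_embedding (states M \<times> states M) (estep M)"
    and test_empty: "test M {} = \<bottom>"
    and pstep_empty: "pstep M {} = \<bottom>"
    and estep_empty: "estep M {} = \<bottom>"
    and test_states: "test M (states M) = nil M"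
    and atomic_subalgebra: "complete_boolean_subalgebra (atomic M)"
    and pstep_atomic: "r \<subseteq> states M \<times> states M \<Longrightarrow> pstep M r \<in> atomic M"
    and estep_atomic: "r \<subseteq> states M \<times> states M \<Longrightarrow> estep M r \<in> atomic M"
    and steps_complementary: "complementary_in (atomic M) (any_pstep M) (any_estep M)"
    and wconj_chaos: "c \<Cap> chaos M = c"
    and atomic_wconj: "a \<in> atomic M \<Longrightarrow> a = a \<Cap> (any_step M ;; chaos M)"
    \<comment> \<open>axioms shared by the three localisation operators\<close>
    and loc_extensive: "\<lbrakk>F \<in> {E M, E_first M, E_last M}; x \<in> vars M\<rbrakk> \<Longrightarrow> c \<le> F x c"
    and loc_inf: "\<lbrakk>F \<in> {E M, E_first M, E_last M}; x \<in> vars M\<rbrakk>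
      \<Longrightarrow> F x (c \<sqinter> F x d) = F x c \<sqinter> F x d"
    and loc_commute: "\<lbrakk>F \<in> {E M, E_first M, E_last M}; x \<in> vars M; y \<in> vars M\<rbrakk>
      \<Longrightarrow> F x (F y c) = F y (F x c)"
    and loc_Sup: "\<lbrakk>F \<in> {E M, E_first M, E_last M}; x \<in> vars M\<rbrakk>
      \<Longrightarrow> F x (\<Squnion>C) = (\<Squnion>c\<in>C. F x c)"
    \<comment> \<open>axioms relating the localisation operators to each other\<close>
    and E_first_le: "x \<in> vars M \<Longrightarrow> E_first M x c \<le> E M x c"
    and E_last_le: "x \<in> vars M \<Longrightarrow> E_last M x c \<le> E M x c"
    and E_E_first: "\<lbrakk>x \<in> vars M; y \<in> vars M\<rbrakk>
      \<Longrightarrow> E M x (E_first M y c) = E_first M y (E M x c)"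
    and E_E_last: "\<lbrakk>x \<in> vars M; y \<in> vars M\<rbrakk>
      \<Longrightarrow> E M x (E_last M y c) = E_last M y (E M x c)"
    and E_first_E_last: "\<lbrakk>x \<in> vars M; y \<in> vars M\<rbrakk>
      \<Longrightarrow> E_first M x (E_last M y c) = E_last M y (E_first M x c)"
    \<comment> \<open>localisation of the primitive commands\<close>
    and loc_test: "\<lbrakk>F \<in> {E M, E_first M, E_last M}; x \<in> vars M; p \<subseteq> states M\<rbrakk>
      \<Longrightarrow> F x (test M p) = test M (E_set M x p)"
    and E_step: "\<lbrakk>f \<in> {pstep M, estep M}; x \<in> vars M; r \<subseteq> states M \<times> states M\<rbrakk>
      \<Longrightarrow> E M x (f r) = f (E_rel M x r)"
    and E_first_step: "\<lbrakk>f \<in> {pstep M, estep M}; x \<in> vars M; r \<subseteq> states M \<times> states M\<rbrakk>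
      \<Longrightarrow> E_first M x (f r) = f (E_first_rel M x r)"
    and E_last_step: "\<lbrakk>f \<in> {pstep M, estep M}; x \<in> vars M; r \<subseteq> states M \<times> states M\<rbrakk>
      \<Longrightarrow> E_last M x (f r) = f (E_last_rel M x r)"
    \<comment> \<open>localisation of composite commands\<close>
    and E_seq_first: "x \<in> vars M \<Longrightarrow> E M x (c ;; E_first M x d) = E M x c ;; E M x d"
    and E_seq_last: "x \<in> vars M \<Longrightarrow> E M x (E_last M x c ;; d) = E M x c ;; E M x d"
    and E_first_seq: "\<lbrakk>x \<in> vars M; c = c \<Cap> (any_step M ;; chaos M)\<rbrakk>
      \<Longrightarrow> E_first M x (c ;; d) = E_first M x c ;; d"
    and E_last_seq: "\<lbrakk>x \<in> vars M; c = c \<Cap> (any_step M ;; chaos M)\<rbrakk>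
      \<Longrightarrow> E_last M x (d ;; c) = d ;; E_last M x c"
    and E_wconj: "x \<in> vars M \<Longrightarrow> E M x (c \<Cap> E M x d) = E M x c \<Cap> E M x d"
    and E_first_wconj: "x \<in> vars M
      \<Longrightarrow> E_first M x (c \<Cap> E_first M x d) = E_first M x c \<Cap> E_first M x d"
    and E_infiter: "\<lbrakk>x \<in> vars M; a \<in> atomic M; E M x a = E_last M x a\<rbrakk>
      \<Longrightarrow> E M x (infiter M a) = infiter M (E M x a)"
    \<comment> \<open>Known properties of the underlying rely/guarantee algebra. Some of them need distribution laws
        for \<open>;;\<close> and \<open>\<Cap>\<close> that are not listed above.\<close>
    and rely_eq: "r \<subseteq> states M \<times> states M
      \<Longrightarrow> rely M r = omega M (any_step M) ;; (nil M \<squnion> (estep M (compl_rel M r) ;; \<top>))"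
    and rely_mono: "\<lbrakk>r1 \<subseteq> r2; r2 \<subseteq> states M \<times> states M\<rbrakk> \<Longrightarrow> rely M r1 \<ge> rely M r2"
    and rely_remove: "r \<subseteq> states M \<times> states M \<Longrightarrow> rely M r \<Cap> c \<ge> c"
    and rely_wconj_rely: "\<lbrakk>r1 \<subseteq> states M \<times> states M; r2 \<subseteq> states M \<times> states M\<rbrakk>
      \<Longrightarrow> rely M r1 \<Cap> rely M r2 = rely M (r1 \<inter> r2)"
    and rely_wconj_seq: "r \<subseteq> states M \<times> states M
      \<Longrightarrow> rely M r \<Cap> (c ;; d) \<ge> (rely M r \<Cap> c) ;; (rely M r \<Cap> d)"
    and demand_wconj_rely: "r \<subseteq> states M \<times> states M \<Longrightarrow> demand M r \<Cap> rely M r = demand M r"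

end

(* A rely whose relation ignores x is a fixed point of the localisation operator E x, because all the
   step relations occurring in it ignore x. So rely (E_rel x r) passes out of the local block, where
   r being included in E_rel x r weakens it to rely r; it distributes over the surrounding sequential
   composition and is absorbed by the two idle commands. *)

theory Submission
  imports Defs
begin

lemma id_off_var_refl: "\<sigma> \<in> states M \<Longrightarrow> (\<sigma>, \<sigma>) \<in> id_off_var M x"
  by (simp add: agree_def)

lemma id_off_var_sym: "(\<sigma>, \<sigma>') \<in> id_off_var M x \<Longrightarrow> (\<sigma>', \<sigma>) \<in> id_off_var M x"
  by (auto simp: agree_def)

lemma id_off_var_trans:
  "\<lbrakk>(\<sigma>, \<sigma>') \<in> id_off_var M x; (\<sigma>', \<sigma>'') \<in> id_off_var M x\<rbrakk> \<Longrightarrow> (\<sigma>, \<sigma>'') \<in> id_off_var M x"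
  by (auto simp: agree_def)

lemma id_off_var_subset: "id_off_var M x \<subseteq> states M \<times> states M"
  by (auto simp: agree_def)

lemma E_set_states: "E_set M x (states M) = states M"
  using id_off_var_refl[of _ M x] id_off_var_subset[of M x] unfolding E_set_def by blast

lemma E_rel_subset: "E_rel M x r \<subseteq> states M \<times> states M"
  using id_off_var_subset[of M x] unfolding E_rel_def by blast

lemma E_rel_extensive:
  assumes "r \<subseteq> states M \<times> states M"
  shows "r \<subseteq> E_rel M x r"
  using assms id_off_var_refl[of _ M x] unfolding E_rel_def by blast

lemma E_rel_idem: "E_rel M x (E_rel M x r) = E_rel M x r"
proof
  show "E_rel M x (E_rel M x r) \<subseteq> E_rel M x r"
    unfolding E_rel_def by (blast intro: id_off_var_trans)
qed (rule E_rel_extensive[OF E_rel_subset])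

lemma E_rel_states: "E_rel M x (states M \<times> states M) = states M \<times> states M"
  using E_rel_extensive[OF subset_refl] E_rel_subset by (rule subset_antisym[rotated])

text \<open>Since \<open>id_off_var M x\<close> is reflexive on states,
  \<open>E_first_rel M x r\<close> is squeezed between \<open>r\<close> and
  \<open>E_rel M x r\<close>.\<close>

lemma E_first_rel_eq:
  assumes "E_rel M x r = r"
  shows "E_first_rel M x r = r"
proof
  show "E_first_rel M x r \<subseteq> r"
  proof
    fix p assume "p \<in> E_first_rel M x r"
    then obtain \<sigma> \<sigma>' \<sigma>'' where p: "p = (\<sigma>, \<sigma>'')" "(\<sigma>, \<sigma>') \<in> id_off_var M x" "(\<sigma>', \<sigma>'') \<in> r"
      unfolding E_first_rel_def by blast
    moreover have "\<sigma>'' \<in> states M"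
      using p(3) E_rel_subset[of M x r] assms by blast
    ultimately have "p \<in> E_rel M x r"
      using id_off_var_refl[of \<sigma>'' M x] unfolding E_rel_def by blast
    then show "p \<in> r" using assms by simp
  qed
  show "r \<subseteq> E_first_rel M x r"
    using E_rel_subset[of M x r] id_off_var_refl[of _ M x] unfolding assms E_first_rel_def
    by blast
qed

lemma E_last_rel_states: "E_last_rel M x (states M \<times> states M) = states M \<times> states M"
  using id_off_var_refl[of _ M x] id_off_var_subset[of M x] unfolding E_last_rel_def by blast

text \<open>The fixed points of \<open>E_rel M x\<close> are the unions of classes of an equivalence
  relation on pairs of states, and the complement of such a union is again one.\<close>

lemma E_rel_compl_rel:
  assumes "E_rel M x r = r"
  shows "E_rel M x (compl_rel M r) = compl_rel M r"
proof
  show "E_rel M x (compl_rel M r) \<subseteq> compl_rel M r"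
  proof
    fix p assume "p \<in> E_rel M x (compl_rel M r)"
    then obtain \<sigma>1 \<sigma>2 \<sigma>3 \<sigma>4
      where p: "p = (\<sigma>1, \<sigma>4)" "(\<sigma>1, \<sigma>2) \<in> id_off_var M x"
        "(\<sigma>2, \<sigma>3) \<in> compl_rel M r" "(\<sigma>3, \<sigma>4) \<in> id_off_var M x"
      unfolding E_rel_def by blast
    have "p \<notin> r"
    proof
      assume "p \<in> r"
      \<comment> \<open>Symmetry allows both changes of \<open>x\<close> to be undone, leading from
        \<open>p\<close> back to the pair outside \<open>r\<close>.\<close>
      then have "(\<sigma>2, \<sigma>3) \<in> E_rel M x r"
        using p id_off_var_sym[of _ _ M x] unfolding E_rel_def by blast
      then show False using p(3) assms by (simp add: compl_rel_def)
    qed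
    then show "p \<in> compl_rel M r"
      using p id_off_var_subset[of M x] unfolding compl_rel_def by blast
  qed
qed (rule E_rel_extensive, simp add: compl_rel_def)

context localisation_algebra
begin

lemma loc_sup:
  assumes "F \<in> {E M, E_first M, E_last M}" "x \<in> vars M"
  shows "F x (c \<squnion> d) = F x c \<squnion> F x d"
  using loc_Sup[OF assms, of "{c, d}"] by simp

lemma E_top: "x \<in> vars M \<Longrightarrow> E M x \<top> = \<top>"
  by (rule top_le, rule loc_extensive) auto

lemma E_first_top: "x \<in> vars M \<Longrightarrow> E_first M x \<top> = \<top>"
  by (rule top_le, rule loc_extensive) auto

lemma loc_nil:
  assumes "F \<in> {E M, E_first M, E_last M}" "x \<in> vars M"
  shows "F x (nil M) = nil M"
  using loc_test[OF assms, of "states M"] by (simp add: E_set_states test_states)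

text \<open>Complementarity makes \<open>any_step M\<close> the join of all atomic commands, and the
  subalgebra is closed under joins.\<close>

lemma any_step_atomic: "any_step M \<in> atomic M"
  using atomic_subalgebra steps_complementary
  by (auto simp: any_step_def complementary_in_def complete_boolean_subalgebra_def)

lemma E_any_step: "x \<in> vars M \<Longrightarrow> E M x (any_step M) = any_step M"
  by (simp add: any_step_def any_pstep_def any_estep_def loc_sup E_step E_rel_states)

lemma E_last_any_step: "x \<in> vars M \<Longrightarrow> E_last M x (any_step M) = any_step M"
  by (simp add: any_step_def any_pstep_def any_estep_def loc_sup E_last_step E_last_rel_states)

text \<open>The assumption on \<open>E_last\<close> lets \<open>a\<close> be read as
  \<open>E_last M x a\<close>, the form in which \<open>E\<close> distributes over
  \<open>a ;; cpow M a i\<close>.\<close>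

lemma E_cpow:
  assumes "x \<in> vars M" "E_last M x a = a"
  shows "E M x (cpow M a i) = cpow M (E M x a) i"
proof (induction i)
  case 0
  then show ?case using assms by (simp add: loc_nil)
next
  case (Suc i)
  then show ?case using assms E_seq_last[of x a "cpow M a i"] by simp
qed

lemma E_star:
  assumes "x \<in> vars M" "E_last M x a = a"
  shows "E M x (star M a) = star M (E M x a)"
  using assms by (simp add: star_eq loc_Sup E_cpow image_image)

text \<open>The iteration is split into its finite part, a join of powers, and its infinite part,
  where \<open>E_infiter\<close> applies because \<open>E\<close> and \<open>E_last\<close> both fix
  \<open>any_step M\<close>.\<close>

lemma E_chaos: "x \<in> vars M \<Longrightarrow> E M x (chaos M) = chaos M"
  by (simp add: chaos_def omega_eq loc_sup E_star E_infiter any_step_atomic E_any_step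
      E_last_any_step)

lemma E_rely:
  assumes x: "x \<in> vars M" and r: "E_rel M x r = r"
  shows "E M x (rely M r) = rely M r"
proof -
  \<comment> \<open>By \<open>rely_eq\<close> the rely is \<open>chaos M ;; ?X\<close>, so the only
    iteration left is that of the atomic command \<open>any_step M\<close>.\<close>
  let ?s = "compl_rel M r" and ?X = "nil M \<squnion> estep M (compl_rel M r) ;; \<top>"
  have r_sub: "r \<subseteq> states M \<times> states M"
    using E_rel_subset[of M x r] r by simp
  have s_sub: "?s \<subseteq> states M \<times> states M"
    by (simp add: compl_rel_def)
  have s: "E_rel M x ?s = ?s" "E_first_rel M x ?s = ?s"
    using r by (simp_all add: E_rel_compl_rel E_first_rel_eq)
  \<comment> \<open>Invariance under \<open>E_first\<close> as well as \<open>E\<close> is needed: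
    \<open>E\<close> distributes over \<open>chaos M ;; ?X\<close> only when \<open>?X\<close> is of
    the form \<open>E_first M x d\<close>.\<close>
  have first: "E_first M x ?X = ?X"
    using x s s_sub by (simp add: loc_sup loc_nil E_first_step
      E_first_seq[OF x atomic_wconj[OF estep_atomic[OF s_sub]]])
  have "E M x (estep M ?s ;; \<top>) = estep M ?s ;; \<top>"
    using E_seq_first[OF x, of "estep M ?s" \<top>] x s s_sub
    by (simp add: E_first_top E_top E_step)
  then have "E M x ?X = ?X"
    using x by (simp add: loc_sup loc_nil)
  then have "E M x (chaos M ;; ?X) = chaos M ;; ?X"
    using E_seq_first[OF x, of "chaos M" ?X] first E_chaos[OF x] by simp
  then show ?thesis
    using rely_eq[OF r_sub] by (simp add: chaos_def)
qed

text \<open>Because \<open>E\<close> fixes \<open>rely M r\<close>, this conjunct has the form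
  \<open>E M x d\<close> and leaves the scope of \<open>E\<close> by \<open>E_wconj\<close>.\<close>

lemma local_block_wconj_rely:
  assumes x: "x \<in> vars M" and r: "E_rel M x r = r"
  shows "local_block M x (c \<Cap> rely M r) = rely M r \<Cap> local_block M x c"
proof -
  have "E M x (demand M (id_on_var M x) \<Cap> (c \<Cap> rely M r))
      = E M x (demand M (id_on_var M x) \<Cap> c) \<Cap> rely M r"
    using E_wconj[OF x, of "demand M (id_on_var M x) \<Cap> c" "rely M r"] E_rely[OF assms]
    by (simp add: wconj_assoc)
  then show ?thesis
    by (simp add: local_block_def wconj_assoc wconj_commute[of "rely M r"])
qed

lemma var_block_wconj_rely:
  assumes x: "x \<in> vars M" and r: "r \<subseteq> states M \<times> states M"
  shows "var_block M x (c \<Cap> rely M (E_rel M x r)) \<le> var_block M x c \<Cap> rely M r"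
proof -
  let ?l = "local_block M x c"
  have "local_block M x (c \<Cap> rely M (E_rel M x r)) = rely M (E_rel M x r) \<Cap> ?l"
    using x by (rule local_block_wconj_rely[OF _ E_rel_idem])
  also have "\<dots> \<le> rely M r \<Cap> ?l"
    using r by (intro wconj_mono rely_mono E_rel_extensive E_rel_subset order_refl)
  finally have "var_block M x (c \<Cap> rely M (E_rel M x r))
      \<le> (rely M r \<Cap> idle M) ;; ((rely M r \<Cap> ?l) ;; (rely M r \<Cap> idle M))"
    \<comment> \<open>Each \<open>idle M\<close> lies below \<open>rely M r \<Cap> idle M\<close>,
      so all three components now carry the same rely; two uses of \<open>rely_wconj_seq\<close>,
      innermost first, then collect it.\<close>
    unfolding var_block_def by (intro seq_mono rely_remove[OF r])
  also have "\<dots> \<le> (rely M r \<Cap> idle M) ;; (rely M r \<Cap> (?l ;; idle M))"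
    by (intro seq_mono order_refl rely_wconj_seq[OF r])
  also have "\<dots> \<le> rely M r \<Cap> var_block M x c"
    unfolding var_block_def by (rule rely_wconj_seq[OF r])
  finally show ?thesis by (simp add: wconj_commute)
qed

end

theorem mainTheorem6:
  fixes M :: "('v, 's, 'c::{complete_lattice, distrib_lattice}) command_algebra"
    and x :: 'v and c :: 'c and r :: "('v, 's) state rel"
  assumes "localisation_algebra M"
    and "x \<in> vars M"
    and "r \<subseteq> states M \<times> states M"
  shows "var_block M x c \<Cap>\<^bsub>M\<^esub> rely M r \<ge> var_block M x (c \<Cap>\<^bsub>M\<^esub> rely M (E_rel M x r))"
  using assms by (rule localisation_algebra.var_block_wconj_rely)

end
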